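(* Let $q$ be a non-zero real number. Let $M_k$ be a matching of size $k\ge 2$ in a complete bipartite graph $K_{m,n}$, with $\{a,c\}$ and $\{b,d\}$ among its edges, where $a$ and $b$ belong to the same partite set. Then, with respect to the $q$-Laplacian matrix, there is perfect state transfer between the pair states $\frac{1}{\sqrt2}(\mathbf{e}_a-\mathbf{e}_b)$ and $\frac{1}{\sqrt2}(\mathbf{e}_c-\mathbf{e}_d)$ at time $\frac{\pi}{2|q|}$ in the following cases: 1. When $m=n$, in the graph $K_{m,m}-M_k$ obtained by removing the edges in $M_k$. 2. When $m>n$ and $a,b$ lie in the larger partite set (of size $m$), in the graph $K_{m,n}-M_k+E$, where $E$ is a set of edges added within the larger partite set, connecting both $a$ and $b$ to $m-n$ additional vertices (other than $a,b$) of that set, in such a way that the involution $(a\ b)(c\ d)$ is preserved, i.e. remains an automorphism of the resulting graph.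
   Context: Graphs here are unweighted, without potentials. For a graph with adjacency matrix $A$ and diagonal degree matrix $\Delta$, the $q$-Laplacian matrix is $\mathscr{L}=(1-q^2)I+q^2\Delta-qA$, and $U_{\mathscr{L}}(t)=\exp(it\mathscr{L})$. $\mathbf{e}_v$ is the characteristic vector of vertex $v$. Perfect state transfer between unit vectors $\mathbf{x},\mathbf{y}$ at time $\tau>0$ means $U_{\mathscr{L}}(\tau)\mathbf{x}=\gamma\mathbf{y}$ for some $\gamma\in\mathbb{C}$. *)

theory Defs
  imports "HOL-Analysis.Analysis" "HOL-Combinatorics.Transposition"
begin

(* A simple graph on the vertex type 'v is given by its set of edges, each edge being a
   two-element set of vertices. *)

definition neighbours :: "'v set set \<Rightarrow> 'v \<Rightarrow> 'v set" where
  "neighbours E u = {v. {u, v} \<in> E}"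

definition complete_bipartite :: "'v set \<Rightarrow> 'v set \<Rightarrow> 'v set set" where
  "complete_bipartite X Y = {{x, y} |x y. x \<in> X \<and> y \<in> Y}"

definition matching_in :: "'v set set \<Rightarrow> 'v set set \<Rightarrow> bool" where
  "matching_in E M \<longleftrightarrow> M \<subseteq> E \<and> pairwise disjnt M"

definition graph_automorphism :: "'v set set \<Rightarrow> ('v \<Rightarrow> 'v) \<Rightarrow> bool" where
  "graph_automorphism E \<phi> \<longleftrightarrow> bij \<phi> \<and> (\<forall>u v. {\<phi> u, \<phi> v} \<in> E \<longleftrightarrow> {u, v} \<in> E)"

definition adjacency_matrix :: "'v set set \<Rightarrow> real ^ 'v ^ 'v::finite" where
  "adjacency_matrix E = (\<chi> u v. if {u, v} \<in> E then 1 else 0)"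

definition degree_matrix :: "'v set set \<Rightarrow> real ^ 'v ^ 'v::finite" where
  "degree_matrix E = (\<chi> u v. if u = v then real (card (neighbours E u)) else 0)"

definition q_laplacian :: "real \<Rightarrow> 'v set set \<Rightarrow> real ^ 'v ^ 'v::finite" where
  "q_laplacian q E =
     (1 - q\<^sup>2) *\<^sub>R mat 1 + q\<^sup>2 *\<^sub>R degree_matrix E - q *\<^sub>R adjacency_matrix E"

(* The overloaded exp is not available for this matrix type (its pointwise multiplication is
   not the matrix product), so the exponential series is written out. *)

definition matrix_exp :: "complex ^ 'v ^ 'v \<Rightarrow> complex ^ 'v ^ 'v::finite" where
  "matrix_exp A = (\<Sum>k. (1 / fact k) *\<^sub>R (((**) A ^^ k) (mat 1)))"

lemma summable_matrix_exp:
  fixes A :: "complex ^ 'v ^ 'v::finite"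
  shows "summable (\<lambda>k. (1 / fact k) *\<^sub>R (((**) A ^^ k) (mat 1)))"
proof -
  have "linear ((**) A :: complex ^ 'v ^ 'v \<Rightarrow> complex ^ 'v ^ 'v)"
    by (rule linearI)
      (simp_all add: matrix_matrix_mult_def vec_eq_iff scaleR_sum_right distrib_left sum.distrib)
  then obtain K where "K > 0" and K: "\<And>B :: complex ^ 'v ^ 'v. norm (A ** B) \<le> norm B * K"
    using linear_conv_bounded_linear bounded_linear.pos_bounded by blast
  have power_bound: "norm (((**) A ^^ k) (mat 1)) \<le> K ^ k * norm (mat 1 :: complex ^ 'v ^ 'v)"
    for k
  proof (induction k)
    case (Suc k)
    have "norm (((**) A ^^ Suc k) (mat 1)) \<le> norm (((**) A ^^ k) (mat 1)) * K"
      using K by simp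
    also have "\<dots> \<le> (K ^ k * norm (mat 1 :: complex ^ 'v ^ 'v)) * K"
      using Suc \<open>K > 0\<close> by (intro mult_right_mono) auto
    finally show ?case by (simp add: mult_ac)
  qed simp
  show ?thesis
  proof (rule summable_comparison_test')
    show "summable (\<lambda>k. (inverse (fact k) * K ^ k) * norm (mat 1 :: complex ^ 'v ^ 'v))"
      by (intro summable_mult2 summable_exp)
    show "norm ((1 / fact k) *\<^sub>R (((**) A ^^ k) (mat 1)))
        \<le> (inverse (fact k) * K ^ k) * norm (mat 1 :: complex ^ 'v ^ 'v)" if "k \<ge> 0" for k
      using power_bound[of k] by (simp add: field_simps)
  qed
qed

definition transition_matrix :: "real ^ 'v ^ 'v \<Rightarrow> real \<Rightarrow> complex ^ 'v ^ 'v::finite" where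
  "transition_matrix L t = matrix_exp (\<chi> u v. \<i> * of_real t * of_real (L $ u $ v))"

definition perfect_state_transfer ::
    "real ^ 'v ^ 'v \<Rightarrow> complex ^ 'v \<Rightarrow> complex ^ 'v::finite \<Rightarrow> real \<Rightarrow> bool" where
  "perfect_state_transfer L x y \<tau> \<longleftrightarrow>
     norm x = 1 \<and> norm y = 1 \<and> \<tau> > 0 \<and> (\<exists>\<gamma>. transition_matrix L \<tau> *v x = \<gamma> *s y)"

definition pair_state :: "'v \<Rightarrow> 'v \<Rightarrow> complex ^ 'v::finite" where
  "pair_state u v = (1 / sqrt 2) *\<^sub>R (axis u 1 - axis v 1)"

end

theory Submission
  imports Defs
begin

text \<open>
  Write \<open>x = e\<^sub>a - e\<^sub>b\<close> and \<open>y = e\<^sub>c - e\<^sub>d\<close>. The vertices \<open>a\<close> and \<open>b\<close> have the same neighbours,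
  except that removing the matching edges leaves \<open>d\<close> adjacent to \<open>a\<close> only and \<open>c\<close> adjacent to
  \<open>b\<close> only; so the adjacency matrix sends \<open>x\<close> to \<open>-y\<close>, and by the same argument on the other
  side it sends \<open>y\<close> to \<open>-x\<close>. Vertices \<open>c\<close> and \<open>d\<close> have degree \<open>m - 1\<close>, while \<open>a\<close> and \<open>b\<close> have
  degree \<open>n - 1\<close> inside the bipartite graph; the \<open>m - n\<close> added edges at each of \<open>a\<close> and \<open>b\<close> make
  all four degrees equal to \<open>m - 1\<close>. Hence the \<open>q\<close>-Laplacian \<open>L\<close> acts on the span of \<open>x\<close> and \<open>y\<close>
  by \<open>L x = \<alpha> x + q y\<close> and \<open>L y = \<alpha> y + q x\<close>, with \<open>\<alpha> = (1 - q\<^sup>2) + q\<^sup>2 (m - 1)\<close>.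

  Consequently \<open>x + y\<close> and \<open>x - y\<close> are eigenvectors with eigenvalues \<open>\<alpha> + q\<close> and \<open>\<alpha> - q\<close>, and
  the evolution from \<open>x\<close> is \<open>exp (\<i> t \<alpha>) (cos (q t) x + \<i> sin (q t) y)\<close>. The cosine
  vanishes at \<open>t = \<pi> / (2 \<bar>q\<bar>)\<close>, and only the \<open>y\<close> component remains. The dynamical half is
  \<open>transition_matrix_quarter_period\<close>; the combinatorial half is
  \<open>complete_bipartite_minus_matching_transfer\<close>, whose hypothesis on \<open>E\<close> is satisfied by the empty
  set when \<open>m = n\<close>, and follows from the automorphism when \<open>m > n\<close>.
\<close>

section \<open>Evolution on an invariant plane\<close>

text \<open>Evaluation at \<open>u\<close> is a continuous linear function of the matrix, so it may be applied to
  the exponential series term by term.\<close>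
lemma matrix_exp_eigenvector:
  fixes A :: "complex ^ 'v ^ 'v::finite" and u :: "complex ^ 'v"
  assumes "A *v u = \<mu> *s u"
  shows "matrix_exp A *v u = exp \<mu> *s u"
proof -
  have pow: "((**) A ^^ k) (mat 1) *v u = \<mu> ^ k *s u" for k
    by (induction k)
      (simp_all add: assms matrix_vector_mul_assoc[symmetric] vector_scalar_commute
        vector_smult_assoc mult.commute)
  have "linear (\<lambda>B :: complex ^ 'v ^ 'v. B *v u)"
    by (rule linearI)
      (simp_all add: matrix_vector_mult_def vec_eq_iff scaleR_sum_right distrib_right sum.distrib)
  then have lin: "bounded_linear (\<lambda>B :: complex ^ 'v ^ 'v. B *v u)"
    by (simp add: linear_conv_bounded_linear)
  have "(\<lambda>k. ((1 / fact k) *\<^sub>R ((**) A ^^ k) (mat 1)) *v u) sums (matrix_exp A *v u)"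
    unfolding matrix_exp_def
    by (rule bounded_linear.sums[OF lin summable_sums[OF summable_matrix_exp]])
  moreover have "((1 / fact k) *\<^sub>R ((**) A ^^ k) (mat 1)) *v u = (\<mu> ^ k /\<^sub>R fact k) *s u" for k
    using linear_scale[OF bounded_linear.linear[OF lin], of "1 / fact k" "((**) A ^^ k) (mat 1)"]
    by (simp add: pow vec_eq_iff divide_inverse)
  ultimately have "(\<lambda>k. (\<mu> ^ k /\<^sub>R fact k) *s u) sums (matrix_exp A *v u)"
    by simp
  moreover have "bounded_linear (\<lambda>z :: complex. z *s u)"
    unfolding linear_conv_bounded_linear[symmetric]
    by (rule linearI) (simp_all add: vec_eq_iff algebra_simps)
  then have "(\<lambda>k. (\<mu> ^ k /\<^sub>R fact k) *s u) sums (exp \<mu> *s u)"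
    by (rule bounded_linear.sums[OF _ exp_converges])
  ultimately show ?thesis
    by (rule sums_unique2)
qed

text \<open>The eigenvectors \<open>x + y\<close> and \<open>x - y\<close> acquire phases whose ratio is \<open>exp (2 \<i> \<tau> q)\<close>. At this
  \<open>\<tau>\<close> the ratio is \<open>-1\<close>, and changing the relative sign of the two turns their half-sum \<open>x\<close> into
  their half-difference \<open>y\<close>.\<close>
lemma transition_matrix_quarter_period:
  fixes L :: "real ^ 'v ^ 'v::finite" and x y :: "complex ^ 'v" and q \<alpha> :: real
  assumes "q \<noteq> 0"
    and Lx: "(\<chi> u v. of_real (L $ u $ v)) *v x = of_real \<alpha> *s x + of_real q *s y"
    and Ly: "(\<chi> u v. of_real (L $ u $ v)) *v y = of_real \<alpha> *s y + of_real q *s x"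
  shows "\<exists>\<gamma>. transition_matrix L (pi / (2 * \<bar>q\<bar>)) *v x = \<gamma> *s y"
proof -
  define \<tau> where "\<tau> = pi / (2 * \<bar>q\<bar>)"
  define C :: "complex ^ 'v ^ 'v" where "C = (\<chi> u v. of_real (L $ u $ v))"
  define U where "U = transition_matrix L \<tau>"
  define \<gamma> :: complex where "\<gamma> = exp (\<i> * of_real \<tau> * of_real (\<alpha> - q))"
  have scale: "(\<chi> u v. \<i> * of_real \<tau> * of_real (L $ u $ v)) *v z = (\<i> * of_real \<tau>) *s (C *v z)"
    for z
    by (simp add: C_def matrix_vector_mult_def vec_eq_iff sum_distrib_left mult.assoc)
  have "C *v (x + y) = of_real (\<alpha> + q) *s (x + y)"
    using Lx Ly by (simp add: C_def matrix_vector_right_distrib vec_eq_iff algebra_simps)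
  then have Up: "U *v (x + y) = exp (\<i> * of_real \<tau> * of_real (\<alpha> + q)) *s (x + y)"
    unfolding U_def transition_matrix_def
    by (intro matrix_exp_eigenvector) (simp only: scale vector_smult_assoc)
  have "C *v (x - y) = of_real (\<alpha> - q) *s (x - y)"
    using Lx Ly
    by (simp add: C_def matrix_vector_mult_diff_distrib vec_eq_iff algebra_simps)
  then have Um: "U *v (x - y) = exp (\<i> * of_real \<tau> * of_real (\<alpha> - q)) *s (x - y)"
    unfolding U_def transition_matrix_def
    by (intro matrix_exp_eigenvector) (simp only: scale vector_smult_assoc)
  have "exp (\<i> * of_real \<tau> * of_real (\<alpha> + q))
      = exp (\<i> * of_real \<tau> * of_real (\<alpha> - q)) * exp (of_real (2 * \<tau> * q) * \<i>)"
    by (simp add: exp_add[symmetric] algebra_simps)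
  moreover have "2 * \<tau> * q = pi \<or> 2 * \<tau> * q = - pi"
    using \<open>q \<noteq> 0\<close> by (cases "q > 0") (auto simp: \<tau>_def field_simps)
  then have "exp (of_real (2 * \<tau> * q) * \<i>) = (-1 :: complex)"
    by (elim disjE; simp only:) (simp_all add: exp_minus)
  ultimately have phase: "exp (\<i> * of_real \<tau> * of_real (\<alpha> + q))
      = - exp (\<i> * of_real \<tau> * of_real (\<alpha> - q))"
    by simp
  have "U *v (x + y) = U *v x + U *v y" "U *v (x - y) = U *v x - U *v y"
    by (simp_all add: matrix_vector_right_distrib matrix_vector_mult_diff_distrib)
  with Up Um have "U *v x + U *v y = - \<gamma> *s (x + y)" "U *v x - U *v y = \<gamma> *s (x - y)"
    unfolding phase \<gamma>_def by simp_all
  then have sums: "(U *v x) $ i + (U *v y) $ i = - \<gamma> * (x $ i + y $ i)"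
    "(U *v x) $ i - (U *v y) $ i = \<gamma> * (x $ i - y $ i)" for i
    by (metis vector_add_component vector_minus_component vector_smult_component)+
  have "(U *v x) $ i = - \<gamma> * y $ i" for i
    using sums[of i] by algebra
  then have "U *v x = - \<gamma> *s y"
    by (simp add: vec_eq_iff)
  then show ?thesis
    unfolding U_def \<tau>_def by blast
qed

section \<open>Pair states and the Laplacian\<close>

lemma norm_pair_state:
  fixes a b :: "'v::finite"
  assumes "a \<noteq> b"
  shows "norm (pair_state a b) = 1"
proof -
  have "(norm ((axis a 1 - axis b 1 :: complex ^ 'v) $ i))\<^sup>2
      = (if i = a then 1 else 0) + (if i = b then 1 else 0)" for i
    using assms by (simp add: axis_def)
  then have "norm (axis a 1 - axis b 1 :: complex ^ 'v) = sqrt 2"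
    by (simp add: norm_vec_def L2_set_def sum.distrib del: vector_minus_component)
  then show ?thesis
    by (simp add: pair_state_def)
qed

text \<open>Column \<open>a\<close> minus column \<open>b\<close> of the \<open>q\<close>-Laplacian: the diagonal contributes the first term
  because the two degrees agree, and the adjacency matrix contributes the second.\<close>
lemma q_laplacian_pair_state:
  fixes G :: "'v::finite set set"
  assumes deg: "card (neighbours G a) = r" "card (neighbours G b) = r"
    and adj: "\<And>v. (of_bool ({a, v} \<in> G) - of_bool ({b, v} \<in> G) :: real)
      = of_bool (v = d) - of_bool (v = c)"
  shows "(\<chi> u v. of_real (q_laplacian q G $ u $ v)) *v pair_state a b
    = of_real (1 - q\<^sup>2 + q\<^sup>2 * real r) *s pair_state a b + of_real q *s pair_state c d"
proof -
  let ?C = "(\<chi> u v. of_real (q_laplacian q G $ u $ v)) :: complex ^ 'v ^ 'v"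
  have entry: "q_laplacian q G $ v $ w
      = (1 - q\<^sup>2 + q\<^sup>2 * real (card (neighbours G w))) * of_bool (v = w)
        - q * of_bool ({w, v} \<in> G)" for v w
    by (auto simp: q_laplacian_def mat_def degree_matrix_def adjacency_matrix_def insert_commute)
  have diff: "q_laplacian q G $ v $ a - q_laplacian q G $ v $ b
      = (1 - q\<^sup>2 + q\<^sup>2 * real r) * (of_bool (v = a) - of_bool (v = b))
        + q * (of_bool (v = c) - of_bool (v = d))" for v
  proof -
    have "q_laplacian q G $ v $ a - q_laplacian q G $ v $ b
        = (1 - q\<^sup>2 + q\<^sup>2 * real r) * (of_bool (v = a) - of_bool (v = b))
          - q * (of_bool ({a, v} \<in> G) - of_bool ({b, v} \<in> G))"
      unfolding entry deg by (simp only: right_diff_distrib)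
    then show ?thesis
      unfolding adj by (simp add: right_diff_distrib)
  qed
  have "?C *v (axis a 1 - axis b 1)
      = of_real (1 - q\<^sup>2 + q\<^sup>2 * real r) *s (axis a 1 - axis b 1)
        + of_real q *s (axis c 1 - axis d 1)"
  proof (subst vec_eq_iff, intro allI)
    fix v
    have ax: "(axis w 1 :: complex ^ 'v) $ v = of_real (of_bool (v = w))" for w
      by (simp add: axis_def)
    have "?C *v axis w 1 = column w ?C" for w
      by (simp add: vec_eq_iff column_def matrix_vector_mult_def axis_def if_distrib cong: if_cong)
    then have "(?C *v (axis a 1 - axis b 1)) $ v
        = of_real (q_laplacian q G $ v $ a - q_laplacian q G $ v $ b)"
      by (simp add: matrix_vector_mult_diff_distrib column_def)
    then show "(?C *v (axis a 1 - axis b 1)) $ v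
        = (of_real (1 - q\<^sup>2 + q\<^sup>2 * real r) *s (axis a 1 - axis b 1)
          + of_real q *s (axis c 1 - axis d 1)) $ v"
      unfolding diff by (simp only: vector_add_component vector_minus_component
          vector_smult_component ax of_real_add of_real_diff of_real_mult)
  qed
  moreover have scale: "pair_state v w = complex_of_real (1 / sqrt 2) *s (axis v 1 - axis w 1)"
    for v w :: 'v
    unfolding pair_state_def vec_eq_iff vector_scaleR_component vector_smult_component
    by (simp add: scaleR_conv_of_real)
  ultimately show ?thesis
    unfolding scale
    by (simp only: vector_scalar_commute vector_smult_assoc vector_add_ldistrib mult.commute)
qed

section \<open>Bipartite graphs without a matching\<close>

lemma complete_bipartite_edge_iff:
  assumes "X \<inter> Y = {}" and "u \<in> X"
  shows "{u, v} \<in> complete_bipartite X Y \<longleftrightarrow> v \<in> Y"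
  using assms by (auto simp: complete_bipartite_def doubleton_eq_iff)

lemma complete_bipartite_commute: "complete_bipartite X Y = complete_bipartite Y X"
  unfolding complete_bipartite_def by (force simp: insert_commute)

lemma matching_in_partner_iff:
  assumes "matching_in E M" and "{a, c} \<in> M"
  shows "{a, v} \<in> M \<longleftrightarrow> v = c"
  using assms unfolding matching_in_def pairwise_def disjnt_def
  by (metis disjoint_insert(1) doubleton_eq_iff insertI1)

text \<open>The extra edges \<open>E\<close> equalise the degrees of the four vertices. Requiring \<open>a\<close> and \<open>b\<close> to have
  the same neighbours in \<open>E\<close> makes these edges cancel in the difference of columns \<open>a\<close> and \<open>b\<close>.\<close>
lemma complete_bipartite_minus_matching_transfer:
  fixes q :: real and X Y :: "'v::finite set"
  assumes "q \<noteq> 0" and disj: "X \<inter> Y = {}" and cover: "X \<union> Y = UNIV"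
    and le: "card Y \<le> card X"
    and M: "matching_in (complete_bipartite X Y) M"
    and ac: "{a, c} \<in> M" and bd: "{b, d} \<in> M" and "{a, c} \<noteq> {b, d}"
    and "a \<in> X" and "b \<in> X"
    and E: "\<And>e. e \<in> E \<Longrightarrow> e \<subseteq> X"
    and twins: "neighbours E a = neighbours E b"
    and extra: "card (neighbours E a) = card X - card Y"
  shows "perfect_state_transfer (q_laplacian q ((complete_bipartite X Y - M) \<union> E))
    (pair_state a b) (pair_state c d) (pi / (2 * \<bar>q\<bar>))"
proof -
  let ?G = "(complete_bipartite X Y - M) \<union> E"
  have K: "{u, v} \<in> complete_bipartite X Y \<longleftrightarrow> v \<in> Y" if "u \<in> X" for u v
    using complete_bipartite_edge_iff[OF disj that] .
  have K': "{u, v} \<in> complete_bipartite X Y \<longleftrightarrow> v \<in> X" if "u \<in> Y" for u v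
    using complete_bipartite_edge_iff[of Y X u v] disj that complete_bipartite_commute[of X Y]
    by auto
  have partner: "{u, v} \<in> M \<longleftrightarrow> v = w" if "{u, w} \<in> M" for u v w
    using matching_in_partner_iff[OF M that] .
  have ca: "{c, a} \<in> M" and db: "{d, b} \<in> M"
    using ac bd by (simp_all add: insert_commute)
  have "a \<noteq> b"
    using partner[OF ac, of d] bd \<open>{a, c} \<noteq> {b, d}\<close> by auto
  have "c \<noteq> d"
    using partner[OF ca, of b] db \<open>a \<noteq> b\<close> by auto
  have "c \<in> Y" "d \<in> Y"
    using K \<open>a \<in> X\<close> \<open>b \<in> X\<close> M ac bd unfolding matching_in_def by blast+
  have NX: "neighbours ?G u = (Y - {w}) \<union> neighbours E u" if "u \<in> X" "{u, w} \<in> M" for u w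
    using K[OF that(1)] partner[OF that(2)] by (auto simp: neighbours_def)
  have NY: "neighbours ?G u = X - {w}" if "u \<in> Y" "{u, w} \<in> M" for u w
    using K'[OF that(1)] partner[OF that(2)] E that(1) disj by (fastforce simp: neighbours_def)
  have "neighbours E u \<subseteq> X" for u
    using E by (auto simp: neighbours_def)
  then have degX: "card (neighbours ?G u) = card X - 1"
    if "u \<in> X" "{u, w} \<in> M" "w \<in> Y" "card (neighbours E u) = card X - card Y" for u w
  proof -
    have "card (neighbours ?G u) = card (Y - {w}) + card (neighbours E u)"
      unfolding NX[OF that(1,2)]
      using disj \<open>neighbours E u \<subseteq> X\<close> by (intro card_Un_disjoint) auto
    moreover have "card Y > 0"
      using \<open>w \<in> Y\<close> by (auto simp: card_gt_0_iff)
    ultimately show ?thesis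
      using le that(3,4) by simp
  qed
  have degY: "card (neighbours ?G u) = card X - 1" if "u \<in> Y" "{u, w} \<in> M" "w \<in> X" for u w
    using NY[OF that(1,2)] that(3) by simp
  have nb: "{u, v} \<in> ?G \<longleftrightarrow> v \<in> neighbours ?G u" for u v
    by (simp add: neighbours_def)
  have adjX: "(of_bool ({a, v} \<in> ?G) - of_bool ({b, v} \<in> ?G) :: real)
      = of_bool (v = d) - of_bool (v = c)" for v
    unfolding nb NX[OF \<open>a \<in> X\<close> ac] NX[OF \<open>b \<in> X\<close> bd] twins
    using \<open>c \<in> Y\<close> \<open>d \<in> Y\<close> \<open>c \<noteq> d\<close> disj \<open>neighbours E b \<subseteq> X\<close> by auto
  have adjY: "(of_bool ({c, v} \<in> ?G) - of_bool ({d, v} \<in> ?G) :: real)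
      = of_bool (v = b) - of_bool (v = a)" for v
    unfolding nb NY[OF \<open>c \<in> Y\<close> ca] NY[OF \<open>d \<in> Y\<close> db]
    using \<open>a \<in> X\<close> \<open>b \<in> X\<close> \<open>a \<noteq> b\<close> by auto
  show ?thesis
    unfolding perfect_state_transfer_def
  proof (intro conjI)
    show "norm (pair_state a b) = 1" "norm (pair_state c d) = 1"
      using \<open>a \<noteq> b\<close> \<open>c \<noteq> d\<close> by (simp_all add: norm_pair_state)
    show "pi / (2 * \<bar>q\<bar>) > 0"
      using \<open>q \<noteq> 0\<close> by simp
    show "\<exists>\<gamma>. transition_matrix (q_laplacian q ?G) (pi / (2 * \<bar>q\<bar>)) *v pair_state a b
        = \<gamma> *s pair_state c d"
      using \<open>q \<noteq> 0\<close>
        q_laplacian_pair_state[OF degX[OF \<open>a \<in> X\<close> ac \<open>c \<in> Y\<close> extra]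
          degX[OF \<open>b \<in> X\<close> bd \<open>d \<in> Y\<close> extra[unfolded twins]] adjX]
        q_laplacian_pair_state[OF degY[OF \<open>c \<in> Y\<close> ca \<open>a \<in> X\<close>] degY[OF \<open>d \<in> Y\<close> db \<open>b \<in> X\<close>] adjY]
      by (rule transition_matrix_quarter_period)
  qed
qed

section \<open>Balanced and augmented cases\<close>

theorem theorem3:
  fixes q :: real and m n k :: nat
    and X Y :: "'v::finite set" and M :: "'v set set" and a b c d :: 'v
  assumes "q \<noteq> 0"
    and "X \<inter> Y = {}" and "X \<union> Y = UNIV" and "card X = m" and "card Y = n"
    and "matching_in (complete_bipartite X Y) M" and "card M = k" and "k \<ge> 2"
    and "{a, c} \<in> M" and "{b, d} \<in> M" and "{a, c} \<noteq> {b, d}"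
    and "a \<in> X" and "b \<in> X"
  shows "(m = n \<longrightarrow>
           perfect_state_transfer (q_laplacian q (complete_bipartite X Y - M))
             (pair_state a b) (pair_state c d) (pi / (2 * \<bar>q\<bar>))) \<and>
         (m > n \<longrightarrow>
           (\<forall>E. (\<forall>e\<in>E. e \<subseteq> X \<and> card e = 2) \<and>
                neighbours E a \<inter> {a, b} = {} \<and> card (neighbours E a) = m - n \<and>
                neighbours E b \<inter> {a, b} = {} \<and> card (neighbours E b) = m - n \<and>
                graph_automorphism ((complete_bipartite X Y - M) \<union> E)
                  (Transposition.transpose a b \<circ> Transposition.transpose c d) \<longrightarrow>
             perfect_state_transfer (q_laplacian q ((complete_bipartite X Y - M) \<union> E))
               (pair_state a b) (pair_state c d) (pi / (2 * \<bar>q\<bar>))))"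
proof (intro conjI impI allI)
  assume "m = n"
  then have "perfect_state_transfer (q_laplacian q ((complete_bipartite X Y - M) \<union> {}))
      (pair_state a b) (pair_state c d) (pi / (2 * \<bar>q\<bar>))"
    using assms
    by (intro complete_bipartite_minus_matching_transfer) (auto simp: neighbours_def)
  then show "perfect_state_transfer (q_laplacian q (complete_bipartite X Y - M))
      (pair_state a b) (pair_state c d) (pi / (2 * \<bar>q\<bar>))"
    by simp
next
  fix E
  assume "m > n"
  assume "(\<forall>e\<in>E. e \<subseteq> X \<and> card e = 2) \<and>
      neighbours E a \<inter> {a, b} = {} \<and> card (neighbours E a) = m - n \<and>
      neighbours E b \<inter> {a, b} = {} \<and> card (neighbours E b) = m - n \<and>
      graph_automorphism ((complete_bipartite X Y - M) \<union> E)
        (Transposition.transpose a b \<circ> Transposition.transpose c d)"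
  then have E: "\<And>e. e \<in> E \<Longrightarrow> e \<subseteq> X"
    and Na: "neighbours E a \<inter> {a, b} = {}" "card (neighbours E a) = m - n"
    and Nb: "neighbours E b \<inter> {a, b} = {}"
    and aut: "graph_automorphism ((complete_bipartite X Y - M) \<union> E)
        (Transposition.transpose a b \<circ> Transposition.transpose c d)"
    by blast+
  have "c \<in> Y" "d \<in> Y"
    using assms complete_bipartite_edge_iff[of X Y] unfolding matching_in_def by blast+
  (* An edge at a or b with its other end in X can only come from E, and the involution
     exchanges a and b and fixes the rest of X. *)
  have "v \<in> neighbours E a \<longleftrightarrow> v \<in> neighbours E b" for v
  proof (cases "v \<in> X - {a, b}")
    case True
    have only_E: "{u, v} \<in> (complete_bipartite X Y - M) \<union> E \<longleftrightarrow> {u, v} \<in> E" if "u \<in> X" for u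
      using complete_bipartite_edge_iff[of X Y u v] that True assms(2) by auto
    have swap: "(Transposition.transpose a b \<circ> Transposition.transpose c d) a = b"
      "(Transposition.transpose a b \<circ> Transposition.transpose c d) v = v"
      using True \<open>c \<in> Y\<close> \<open>d \<in> Y\<close> \<open>a \<in> X\<close> assms(2) by (auto simp: Transposition.transpose_def)
    have "{b, v} \<in> (complete_bipartite X Y - M) \<union> E
        \<longleftrightarrow> {a, v} \<in> (complete_bipartite X Y - M) \<union> E"
      using aut swap unfolding graph_automorphism_def by metis
    then show ?thesis
      using only_E \<open>a \<in> X\<close> \<open>b \<in> X\<close> by (simp add: neighbours_def)
  next
    case False
    then show ?thesis
      using Na Nb E by (auto simp: neighbours_def)
  qed
  then show "perfect_state_transfer (q_laplacian q ((complete_bipartite X Y - M) \<union> E))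
      (pair_state a b) (pair_state c d) (pi / (2 * \<bar>q\<bar>))"
    using assms \<open>m > n\<close> E Na(2)
    by (intro complete_bipartite_minus_matching_transfer) auto
qed

end
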